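(* For any $d\in\mathbb{N}$, $a>0$ and $r\in(0,1]$ there exist $C,b>0$ such that: if $\Omega\in\mathbb{K}_d(r)$, then there exists a $C^\infty$ plurisubharmonic function $F:\Omega\to[0,1]$ with $$i\partial\bar\partial F(z)\ge C\,i\partial\bar\partial\|z\|^2\quad\text{on } \mathbb{B}_d(e_1;a)\cap\Omega$$ and $$\mathrm{supp}(F)\subset\mathbb{B}_d(e_1;b)\cap\Omega.$$
   Context: $\mathbb{B}_d(z_0;\rho)=\{z\in\mathbb{C}^d:\|z-z_0\|<\rho\}$ with the Euclidean norm, and $\mathrm{supp}(F)$ is the support of $F$ in $\Omega$. A convex domain in $\mathbb{C}^d$ is $\mathbb{C}$-properly convex if it contains no entire complex affine line. With $e_1,\dots,e_d$ the standard basis of $\mathbb{C}^d$ and $\mathbb{D}\subset\mathbb{C}$ the open unit disk, for $r\in(0,1]$ the set $\mathbb{K}_d(r)$ consists of the $\mathbb{C}$-properly convex domains $\Omega\subset\mathbb{C}^d$ such that (i) $r\mathbb{D}\cdot e_1\subset\Omega$ and $\mathbb{D}\cdot e_j\subset\Omega$ for $j=2,\dots,d$; and (ii) for every $j=1,\dots,d$, $e_j\in\partial\Omega$ and $(e_j+\mathrm{Span}_{\mathbb{C}}\{e_{j+1},\dots,e_d\})\cap\Omega=\emptyset$. *)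

theory Defs
  imports "HOL-Analysis.Analysis"
begin

text \<open>
  Complex \<open>d\<close>-space is \<open>complex ^ 'n\<close>, where the finite linear order \<open>'n\<close> plays the role of
  \<open>{1 < \<dots> < d}\<close>; its norm is the Euclidean one. The order matters because the normalisation of
  \<open>\<Omega>\<close> distinguishes the first coordinate and uses the coordinates that follow a given one.
\<close>

abbreviation std_basis :: "'n::finite \<Rightarrow> complex ^ 'n" where
  "std_basis j \<equiv> axis j 1"

abbreviation first_index :: "'n::{finite,linorder}" where
  "first_index \<equiv> Min UNIV"


subsection \<open>Domains\<close>

definition convex_domain :: "'a::real_normed_vector set \<Rightarrow> bool" where
  "convex_domain \<Omega> \<longleftrightarrow> open \<Omega> \<and> convex \<Omega> \<and> \<Omega> \<noteq> {}"

definition C_properly_convex :: "(complex ^ 'n::finite) set \<Rightarrow> bool" where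
  "C_properly_convex \<Omega> \<longleftrightarrow>
     convex_domain \<Omega> \<and> \<not> (\<exists>p v. v \<noteq> 0 \<and> range (\<lambda>\<zeta>. p + \<zeta> *s v) \<subseteq> \<Omega>)"

text \<open>The complex span is \<open>vec.span\<close> (scalars act by \<open>*s\<close>); plain \<open>span\<close> is the real span.\<close>

definition normalized_domains :: "real \<Rightarrow> (complex ^ 'n::{finite,linorder}) set set" where
  "normalized_domains r = {\<Omega>. C_properly_convex \<Omega> \<and>
     (\<forall>\<zeta>\<in>ball 0 1. (complex_of_real r * \<zeta>) *s std_basis first_index \<in> \<Omega>) \<and>
     (\<forall>j. j \<noteq> first_index \<longrightarrow> (\<forall>\<zeta>\<in>ball 0 1. \<zeta> *s std_basis j \<in> \<Omega>)) \<and>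
     (\<forall>j. std_basis j \<in> frontier \<Omega> \<and>
          (+) (std_basis j) ` vec.span (std_basis ` {j<..}) \<inter> \<Omega> = {})}"


subsection \<open>Smooth functions\<close>

text \<open>
  Intended for open \<open>U\<close>: a function is \<open>C\<^sup>k\<^sup>+\<^sup>1\<close> iff it is differentiable and all its directional
  derivatives are \<open>C\<^sup>k\<close>. Derivatives are real ones, also when the domain is a complex space.
\<close>

primrec C_k_on ::
    "nat \<Rightarrow> ('a::real_normed_vector \<Rightarrow> 'b::real_normed_vector) \<Rightarrow> 'a set \<Rightarrow> bool" where
  "C_k_on 0 f U \<longleftrightarrow> continuous_on U f"
| "C_k_on (Suc k) f U \<longleftrightarrow> (\<forall>x\<in>U. f differentiable (at x)) \<and>
     (\<forall>v. C_k_on k (\<lambda>x. frechet_derivative f (at x) v) U)"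

definition C_infinity_on ::
    "('a::real_normed_vector \<Rightarrow> 'b::real_normed_vector) \<Rightarrow> 'a set \<Rightarrow> bool" where
  "C_infinity_on f U \<longleftrightarrow> (\<forall>k. C_k_on k f U)"


subsection \<open>Plurisubharmonic functions\<close>

definition upper_semicontinuous_on :: "'a::topological_space set \<Rightarrow> ('a \<Rightarrow> real) \<Rightarrow> bool" where
  "upper_semicontinuous_on U u \<longleftrightarrow> (\<forall>c. openin (top_of_set U) {x \<in> U. u x < c})"

text \<open>
  Only finite functions are considered. The integral of a function that is not integrable is \<open>0\<close>,
  so integrability is demanded; it costs nothing, as an upper semicontinuous function is bounded
  above on circles and a circle mean of \<open>-\<infinity>\<close> would violate the inequality.
\<close>

definition subharmonic_on :: "complex set \<Rightarrow> (complex \<Rightarrow> real) \<Rightarrow> bool" where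
  "subharmonic_on U u \<longleftrightarrow> upper_semicontinuous_on U u \<and>
     (\<forall>c \<rho>. \<rho> > 0 \<and> cball c \<rho> \<subseteq> U \<longrightarrow>
        (\<lambda>t. u (c + complex_of_real \<rho> * cis t)) absolutely_integrable_on {0..2*pi} \<and>
        u c \<le> 1 / (2*pi) * integral {0..2*pi} (\<lambda>t. u (c + complex_of_real \<rho> * cis t)))"

definition plurisubharmonic_on :: "(complex ^ 'n::finite) set \<Rightarrow> (complex ^ 'n \<Rightarrow> real) \<Rightarrow> bool" where
  "plurisubharmonic_on \<Omega> F \<longleftrightarrow> upper_semicontinuous_on \<Omega> F \<and>
     (\<forall>p v. subharmonic_on {\<zeta>. p + \<zeta> *s v \<in> \<Omega>} (\<lambda>\<zeta>. F (p + \<zeta> *s v)))"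


subsection \<open>The form \<open>i\<partial>\<partial>\<close>-bar\<close>

text \<open>\<open>d_z j\<close> and \<open>d_zbar j\<close> are the Wirtinger derivatives in the \<open>j\<close>-th coordinate.\<close>

definition d_z :: "'n::finite \<Rightarrow> (complex ^ 'n \<Rightarrow> complex) \<Rightarrow> complex ^ 'n \<Rightarrow> complex" where
  "d_z j f z = (frechet_derivative f (at z) (axis j 1)
                 - \<i> * frechet_derivative f (at z) (axis j \<i>)) / 2"

definition d_zbar :: "'n::finite \<Rightarrow> (complex ^ 'n \<Rightarrow> complex) \<Rightarrow> complex ^ 'n \<Rightarrow> complex" where
  "d_zbar j f z = (frechet_derivative f (at z) (axis j 1)
                    + \<i> * frechet_derivative f (at z) (axis j \<i>)) / 2"

text \<open>
  A two-form at a point is given by its values on pairs of tangent vectors. Below,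
  \<open>u $ j * cnj (v $ k) - v $ j * cnj (u $ k)\<close> is the value at \<open>(u, v)\<close> of the wedge product of
  \<open>dz\<^sub>j\<close> with the conjugate of \<open>dz\<^sub>k\<close>.
\<close>

definition i_ddbar ::
    "(complex ^ 'n::finite \<Rightarrow> real) \<Rightarrow> complex ^ 'n \<Rightarrow> complex ^ 'n \<Rightarrow> complex ^ 'n \<Rightarrow> complex" where
  "i_ddbar F z u v = \<i> * (\<Sum>j\<in>UNIV. \<Sum>k\<in>UNIV.
     d_z j (d_zbar k (\<lambda>w. complex_of_real (F w))) z * (u $ j * cnj (v $ k) - v $ j * cnj (u $ k)))"

text \<open>
  The order on real \<open>(1,1)\<close>-forms: \<open>\<beta> - \<alpha>\<close> is non-negative on every \<open>(v, iv)\<close>. These values are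
  real for real \<open>(1,1)\<close>-forms, so taking real parts loses nothing.
\<close>

definition form_le ::
    "(complex ^ 'n::finite \<Rightarrow> complex ^ 'n \<Rightarrow> complex) \<Rightarrow>
     (complex ^ 'n \<Rightarrow> complex ^ 'n \<Rightarrow> complex) \<Rightarrow> bool" where
  "form_le \<alpha> \<beta> \<longleftrightarrow> (\<forall>v. Re (\<alpha> v (\<i> *s v)) \<le> Re (\<beta> v (\<i> *s v)))"

end

theory Submission
  imports Defs "HOL-Complex_Analysis.Cauchy_Integral_Formula"
begin

text \<open>
  Separating \<open>\<Omega>\<close> from the affine subspaces \<open>e\<^sub>j + Span {e\<^sub>k | k > j}\<close> yields linear functionals \<open>L\<^sub>j\<close>
  with \<open>Re L\<^sub>j < 1\<close> on \<open>\<Omega>\<close> and a triangular coefficient matrix that, thanks to the disks in \<open>\<Omega>\<close>, is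
  bounded and uniformly invertible. The functions \<open>h\<^sub>j = 1 / (2 - L\<^sub>j)\<close> are bounded by 1 on \<open>\<Omega>\<close>, and
  their product \<open>P\<close> tends to 0 at infinity. Hence \<open>u = \<bar>P\<bar>\<^sup>2 (1 + \<Sum>j. \<bar>h\<^sub>j\<bar>\<^sup>2)\<close> is a sum of squares of
  holomorphic functions which is small far from \<open>e\<^sub>1\<close> and bounded below near \<open>e\<^sub>1\<close>, and which is
  strictly plurisubharmonic because the ratios \<open>h\<^sub>j\<close> of these functions are local coordinates. Then
  \<open>F = \<psi> (u - s)\<close> works for a small \<open>s > 0\<close> and \<open>\<psi> (t) = exp (- A / t)\<close> (0 for \<open>t \<le> 0\<close>), which is
  convex for \<open>t \<le> A / 2\<close>.
\<close>

subsection \<open>Smooth functions\<close>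

lemma C_k_on_cong:
  assumes "open U" and "\<And>x. x \<in> U \<Longrightarrow> f x = g x"
  shows "C_k_on k f U \<longleftrightarrow> C_k_on k g U"
  using assms
proof (induction k arbitrary: f g)
  case 0
  then show ?case by (simp cong: continuous_on_cong)
next
  case (Suc k)
  have iff: "(f has_derivative D) (at x) \<longleftrightarrow> (g has_derivative D) (at x)" if "x \<in> U" for x D
    using Suc.prems that by (metis has_derivative_transform_within_open)
  then have "frechet_derivative f (at x) = frechet_derivative g (at x)" if "x \<in> U" for x
    using that by (simp add: frechet_derivative_def)
  then have "C_k_on k (\<lambda>x. frechet_derivative f (at x) v) U \<longleftrightarrow>
      C_k_on k (\<lambda>x. frechet_derivative g (at x) v) U" for v
    by (intro Suc.IH) (use Suc.prems in auto)
  then show ?case using iff by (auto simp: differentiable_def)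
qed

lemma C_k_on_SucI:
  assumes "open U" and D: "\<And>x. x \<in> U \<Longrightarrow> (f has_derivative D x) (at x)"
    and "\<And>v. C_k_on k (\<lambda>x. D x v) U"
  shows "C_k_on (Suc k) f U"
proof -
  have "C_k_on k (\<lambda>x. frechet_derivative f (at x) v) U" for v
    using assms(3)[of v] C_k_on_cong[OF assms(1), of "\<lambda>x. frechet_derivative f (at x) v" "\<lambda>x. D x v" k]
    by (simp add: frechet_derivative_at[OF D, symmetric])
  then show ?thesis using D by (auto simp: differentiable_def)
qed

lemma C_k_on_SucD:
  assumes "C_k_on (Suc k) f U"
  shows "\<And>x. x \<in> U \<Longrightarrow> (f has_derivative frechet_derivative f (at x)) (at x)"
    and "\<And>v. C_k_on k (\<lambda>x. frechet_derivative f (at x) v) U"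
  using assms by (auto simp: frechet_derivative_works)

lemma C_k_on_Suc_imp: "C_k_on (Suc k) f U \<Longrightarrow> C_k_on k f U"
proof (induction k arbitrary: f)
  case 0
  then show ?case
    by (auto intro!: continuous_at_imp_continuous_on differentiable_imp_continuous_within)
next
  case (Suc k)
  then show ?case unfolding C_k_on.simps(2)[of "Suc k"] C_k_on.simps(2)[of k] by blast
qed

lemma C_k_on_const: "open U \<Longrightarrow> C_k_on k (\<lambda>x. c) U"
proof (induction k arbitrary: c)
  case (Suc k)
  then show ?case by (intro C_k_on_SucI[where D = "\<lambda>x v. 0"]) auto
qed auto

lemma C_k_on_bounded_linear:
  assumes "open U" "bounded_linear f"
  shows "C_k_on k f U"
proof (cases k)
  case 0
  then show ?thesis
    using assms(2) by (simp add: linear_continuous_on)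
next
  case (Suc m)
  then show ?thesis
    using assms by (auto intro!: C_k_on_SucI[where D = "\<lambda>x. f"] bounded_linear_imp_has_derivative C_k_on_const
        simp del: C_k_on.simps)
qed

lemma C_k_on_add:
  assumes "open U" "C_k_on k f U" "C_k_on k g U"
  shows "C_k_on k (\<lambda>x. f x + g x) U"
  using assms(2,3)
proof (induction k arbitrary: f g)
  case 0
  then show ?case by (auto intro: continuous_intros)
next
  case (Suc k)
  show ?case
    by (rule C_k_on_SucI[OF assms(1) has_derivative_add[OF Suc.prems[THEN C_k_on_SucD(1)]]])
      (assumption | intro Suc.IH C_k_on_SucD(2)[OF Suc.prems(1)] C_k_on_SucD(2)[OF Suc.prems(2)])+
qed

lemma (in bounded_bilinear) C_k_on:
  assumes "open U" "C_k_on k f U" "C_k_on k g U"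
  shows "C_k_on k (\<lambda>x. prod (f x) (g x)) U"
  using assms(2,3)
proof (induction k arbitrary: f g)
  case 0
  then show ?case by (auto intro: continuous_on)
next
  case (Suc k)
  show ?case
    by (rule C_k_on_SucI[OF assms(1) FDERIV[OF Suc.prems[THEN C_k_on_SucD(1)]]], assumption, assumption,
        intro C_k_on_add[OF assms(1)] Suc.IH C_k_on_Suc_imp[OF Suc.prems(1)] C_k_on_Suc_imp[OF Suc.prems(2)]
          C_k_on_SucD(2)[OF Suc.prems(1)] C_k_on_SucD(2)[OF Suc.prems(2)])
qed

lemmas C_k_on_mult = bounded_bilinear.C_k_on[OF bounded_bilinear_mult]
lemmas C_k_on_inner = bounded_bilinear.C_k_on[OF bounded_bilinear_inner]

lemma C_k_on_sum:
  assumes "open U" "\<And>i. i \<in> I \<Longrightarrow> C_k_on k (f i) U"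
  shows "C_k_on k (\<lambda>x. \<Sum>i\<in>I. f i x) U"
  using assms(2)
proof (induction I rule: infinite_finite_induct)
  case (insert i I)
  then show ?case by (simp add: C_k_on_add assms(1))
qed (auto simp: C_k_on_const assms(1))

lemma C_k_on_prod:
  fixes f :: "'i \<Rightarrow> _ \<Rightarrow> 'b::real_normed_field"
  assumes "open U" "\<And>i. i \<in> I \<Longrightarrow> C_k_on k (f i) U"
  shows "C_k_on k (\<lambda>x. \<Prod>i\<in>I. f i x) U"
  using assms(2)
proof (induction I rule: infinite_finite_induct)
  case (insert i I)
  then show ?case by (simp add: C_k_on_mult assms(1))
qed (auto simp: C_k_on_const assms(1))

lemma C_k_on_inverse:
  fixes f :: "_ \<Rightarrow> 'b::real_normed_field"
  assumes "open U" "C_k_on k f U" and nz: "\<And>x. x \<in> U \<Longrightarrow> f x \<noteq> 0"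
  shows "C_k_on k (\<lambda>x. inverse (f x)) U"
  using assms(2)
proof (induction k)
  case 0
  then show ?case using nz by (auto intro!: continuous_on_inverse)
next
  case (Suc k)
  let ?D = "\<lambda>x v. frechet_derivative f (at x) v"
  have inv: "C_k_on k (\<lambda>x. inverse (f x)) U"
    using Suc C_k_on_Suc_imp by blast
  have "C_k_on k (\<lambda>x. (- 1) * (inverse (f x) * ?D x v * inverse (f x))) U" for v
    by (intro C_k_on_mult[OF assms(1)] C_k_on_const assms(1) inv C_k_on_SucD(2)[OF Suc.prems])
  then have "C_k_on k (\<lambda>x. - (inverse (f x) * ?D x v * inverse (f x))) U" for v
    by simp
  then show ?case
    by (intro C_k_on_SucI[OF assms(1) Deriv.has_derivative_inverse[OF nz C_k_on_SucD(1)[OF Suc.prems]]])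
qed

subsection \<open>A flat function\<close>

text \<open>The functions \<open>flat A k\<close> are smooth because their span is closed under differentiation.\<close>

definition flat :: "real \<Rightarrow> nat \<Rightarrow> real \<Rightarrow> real" where
  "flat A k t = (if t \<le> 0 then 0 else exp (- A * inverse t) * inverse t ^ k)"

lemma flat_nonneg: "0 \<le> flat A k t"
  by (simp add: flat_def)

lemma flat_le_square:
  assumes "A > 0"
  shows "flat A k t \<le> fact (k + 2) / A ^ (k + 2) * t\<^sup>2"
proof (cases "t \<le> 0")
  case True
  then show ?thesis using assms by (simp add: flat_def)
next
  case False
  let ?n = "k + 2"
  have "(A / t) ^ ?n / fact ?n \<le> (\<Sum>n. (A / t) ^ n /\<^sub>R fact n)"
    using sum_le_suminf[OF summable_exp_generic[of "A / t"], of "{?n}"] assms False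
    by (auto simp: divide_inverse mult.commute)
  then have "(A / t) ^ ?n \<le> fact ?n * exp (A / t)"
    by (simp only: exp_def pos_divide_le_eq[OF fact_gt_zero] mult.commute)
  then have "A ^ ?n * exp (- A / t) \<le> fact ?n * t ^ ?n"
    using False by (simp add: exp_minus field_simps power_divide del: fact_Suc add_2_eq_Suc')
  then have "A ^ ?n * exp (- A / t) * inverse t ^ k \<le> fact ?n * t ^ ?n * inverse t ^ k"
    using False by (intro mult_right_mono) auto
  also have "t ^ ?n * inverse t ^ k = t\<^sup>2"
    using False by (simp add: power_add power_inverse field_simps power2_eq_square)
  then have "fact ?n * t ^ ?n * inverse t ^ k = fact ?n * t\<^sup>2"
    by (simp only: mult.assoc)
  finally have "A ^ ?n * flat A k t \<le> fact ?n * t\<^sup>2"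
    using False by (simp add: flat_def divide_inverse mult.assoc del: fact_Suc add_2_eq_Suc')
  then show ?thesis using assms
    by (simp only: times_divide_eq_left zero_less_power pos_le_divide_eq) (simp only: mult.commute)
qed

lemma flat_deriv:
  assumes "A > 0"
  shows "(flat A k has_real_derivative A * flat A (k + 2) t - k * flat A (k + 1) t) (at t)"
proof -
  consider "t < 0" | "t = 0" | "t > 0" by linarith
  then show ?thesis
  proof cases
    case 1
    have "((\<lambda>t::real. 0::real) has_real_derivative 0) (at t)" by simp
    then have "(flat A k has_real_derivative 0) (at t)"
      using 1 by (rule_tac has_field_derivative_transform_within_open[where S = "{..<0}"])
        (auto simp: flat_def)
    then show ?thesis using 1 by (simp add: flat_def)
  next
    case 2
    let ?C = "fact (k + 2) / A ^ (k + 2) :: real"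
    have "((\<lambda>h. flat A k h / h) \<longlongrightarrow> 0) (at 0)"
    proof (rule Lim_null_comparison)
      show "\<forall>\<^sub>F h in at 0. norm (flat A k h / h) \<le> ?C * \<bar>h\<bar>"
      proof (intro eventually_at_filter[THEN iffD2] always_eventually allI impI)
        fix h :: real
        assume "h \<noteq> 0"
        then show "norm (flat A k h / h) \<le> ?C * \<bar>h\<bar>"
          using flat_le_square[OF assms, of k h] flat_nonneg[of A k h]
            pos_divide_le_eq[of "\<bar>h\<bar>" "flat A k h" "?C * \<bar>h\<bar>"]
          by (simp only: real_norm_def abs_divide abs_of_nonneg)
            (simp add: power2_eq_square mult.assoc abs_mult_self_eq del: fact_Suc add_2_eq_Suc')
      qed
      show "((\<lambda>h. ?C * \<bar>h\<bar>) \<longlongrightarrow> 0) (at 0)"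
        using assms by (auto intro!: tendsto_eq_intros)
    qed
    then show ?thesis using 2 by (simp add: has_field_derivative_iff flat_def)
  next
    case 3
    let ?d = "\<lambda>t. A * (exp (- A * inverse t) * inverse t ^ (k + 2)) - k * (exp (- A * inverse t) * inverse t ^ (k + 1))"
    have "((\<lambda>t. exp (- A * inverse t) * inverse t ^ k) has_real_derivative ?d t) (at t)"
    proof -
      have e: "((\<lambda>t. exp (- A * inverse t)) has_real_derivative
          exp (- A * inverse t) * (A * (inverse t)\<^sup>2)) (at t)"
        using 3 by (auto intro!: derivative_eq_intros simp: power2_eq_square)
      have "((\<lambda>t. inverse t ^ k) has_real_derivative
          real k * (- (inverse t ^ Suc (Suc 0)) * inverse t ^ (k - Suc 0))) (at t)"
        using 3 by (intro DERIV_power DERIV_inverse) auto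
      then have "((\<lambda>t. inverse t ^ k) has_real_derivative - real k * inverse t ^ (k + 1)) (at t)"
        by (cases k) (auto simp: algebra_simps)
      from DERIV_mult[OF e this] show ?thesis
        by (simp add: algebra_simps power2_eq_square)
    qed
    then have "(flat A k has_real_derivative ?d t) (at t)"
      using 3 by (rule_tac has_field_derivative_transform_within_open[where S = "{0<..}"])
        (auto simp: flat_def)
    then show ?thesis using 3 by (simp add: flat_def)
  qed
qed

lemma C_k_on_flat:
  assumes "open U" "A > 0" "C_k_on n u U"
  shows "C_k_on n (\<lambda>x. flat A k (u x)) U"
  using assms(3)
proof (induction n arbitrary: k)
  case 0
  have "isCont (flat A k) t" for t
    using flat_deriv[OF assms(2)] DERIV_isCont by blast
  then show ?case
    using 0 by (auto intro: continuous_on_compose2[of UNIV] simp: continuous_at_imp_continuous_on)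
next
  case (Suc n)
  let ?g = "\<lambda>x. A * flat A (k + 2) (u x) + (- real k) * flat A (k + 1) (u x)"
  have der: "((\<lambda>x. flat A k (u x)) has_derivative (\<lambda>v. ?g x * frechet_derivative u (at x) v)) (at x)"
    if "x \<in> U" for x
    using has_derivative_compose[OF C_k_on_SucD(1)[OF Suc.prems that]
        flat_deriv[OF assms(2), unfolded has_field_derivative_def]]
    by simp
  show ?case
    by (rule C_k_on_SucI[OF assms(1) der])
      (assumption | intro C_k_on_mult C_k_on_add C_k_on_const Suc.IH C_k_on_Suc_imp[OF Suc.prems]
        C_k_on_SucD(2)[OF Suc.prems] assms(1))+
qed

lemma flat_second_deriv_nonneg:
  assumes "A > 0" "t \<le> A / 2"
  shows "0 \<le> A * (A * flat A 4 t - 2 * flat A 3 t)"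
proof -
  have "A * flat A 4 t - 2 * flat A 3 t = flat A 4 t * (A - 2 * t)"
    by (simp add: flat_def eval_nat_numeral algebra_simps)
  then show ?thesis using assms by (simp add: flat_nonneg)
qed

lemma convex_on_flat:
  assumes "A > 0"
  shows "convex_on {..A / 2} (flat A 0)"
proof (rule f''_ge0_imp_convex)
  fix t :: real
  assume t: "t \<in> {..A / 2}"
  show "(flat A 0 has_real_derivative A * flat A 2 t) (at t)"
    using flat_deriv[OF assms, of 0 t] by (simp add: eval_nat_numeral)
  show "((\<lambda>t. A * flat A 2 t) has_real_derivative A * (A * flat A 4 t - 2 * flat A 3 t)) (at t)"
    using flat_deriv[OF assms, of 2 t]
    by (auto intro!: derivative_eq_intros simp: numeral_eq_Suc)
  show "0 \<le> A * (A * flat A 4 t - 2 * flat A 3 t)"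
    using assms t by (intro flat_second_deriv_nonneg) auto
qed simp

lemma flat_le_1: "A > 0 \<Longrightarrow> flat A 0 t \<le> 1"
  by (simp add: flat_def)

subsection \<open>Subharmonicity\<close>

lemma circle_mean_holomorphic:
  fixes f :: "complex \<Rightarrow> complex"
  assumes "f holomorphic_on cball c \<rho>" "\<rho> > 0"
  shows "((\<lambda>t. f (c + of_real \<rho> * cis t)) has_integral (2 * pi * f c)) {0..2 * pi}"
proof -
  have "((\<lambda>u. f u / (u - c)) has_contour_integral (2 * of_real pi * \<i> * f c)) (circlepath c \<rho>)"
    using Cauchy_integral_circlepath_simple[OF assms(1), of c] assms(2) by simp
  then have "((\<lambda>t. f (c + of_real \<rho> * cis t) / (c + of_real \<rho> * cis t - c) * of_real \<rho> * \<i> * cis t)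
      has_integral (2 * of_real pi * \<i> * f c)) {0..2 * pi}"
    by (simp add: circlepath_def has_contour_integral_part_circlepath_iff)
  then have "((\<lambda>t. \<i> * f (c + of_real \<rho> * cis t)) has_integral (\<i> * (2 * pi * f c))) {0..2 * pi}"
    using assms(2) by (simp add: mult_ac)
  then show ?thesis
    using has_integral_mult_right[of "\<lambda>t. \<i> * f (c + of_real \<rho> * cis t)"
        "\<i> * (2 * pi * f c)" "{0..2 * pi}" "- \<i>"]
    by simp
qed

lemma continuous_on_imp_usc:
  assumes "continuous_on U u"
  shows "upper_semicontinuous_on U u"
proof -
  have "openin (top_of_set U) (U \<inter> u -` {..<c})" for c
    using assms continuous_openin_preimage_gen open_lessThan by blast
  moreover have "U \<inter> u -` {..<c} = {x \<in> U. u x < c}" for c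
    by auto
  ultimately show ?thesis by (simp add: upper_semicontinuous_on_def)
qed

text \<open>
  Linearising \<open>\<psi>\<close> and the squares at the centre \<open>c\<close> bounds \<open>\<psi> (\<Sum>i\<in>I. (norm (g i \<zeta>))\<^sup>2)\<close>
  from below by the real part of a holomorphic function with the same value at \<open>c\<close>.
\<close>

lemma subharmonic_on_convex_sum_squares:
  fixes g :: "'i \<Rightarrow> complex \<Rightarrow> complex" and \<psi> \<psi>' :: "real \<Rightarrow> real"
  assumes "open U" and hol: "\<And>i. i \<in> I \<Longrightarrow> g i holomorphic_on U"
    and cont: "continuous_on U (\<lambda>\<zeta>. \<psi> (\<Sum>i\<in>I. (norm (g i \<zeta>))\<^sup>2))"
    and S: "\<And>\<zeta>. \<zeta> \<in> U \<Longrightarrow> (\<Sum>i\<in>I. (norm (g i \<zeta>))\<^sup>2) \<in> S"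
    and tangent: "\<And>x y. x \<in> S \<Longrightarrow> y \<in> S \<Longrightarrow> \<psi> x + \<psi>' x * (y - x) \<le> \<psi> y"
    and mono: "\<And>x. x \<in> S \<Longrightarrow> 0 \<le> \<psi>' x"
  shows "subharmonic_on U (\<lambda>\<zeta>. \<psi> (\<Sum>i\<in>I. (norm (g i \<zeta>))\<^sup>2))"
  unfolding subharmonic_on_def
proof (intro conjI allI impI)
  show "upper_semicontinuous_on U (\<lambda>\<zeta>. \<psi> (\<Sum>i\<in>I. (norm (g i \<zeta>))\<^sup>2))"
    using cont by (rule continuous_on_imp_usc)
next
  fix c \<rho>
  assume *: "\<rho> > 0 \<and> cball c \<rho> \<subseteq> U"
  let ?u = "\<lambda>\<zeta>. \<Sum>i\<in>I. (norm (g i \<zeta>))\<^sup>2"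
  let ?\<gamma> = "\<lambda>t. c + of_real \<rho> * cis t"
  have \<gamma>: "?\<gamma> t \<in> U" for t
    using * by (auto simp: dist_norm norm_mult intro!: subsetD[of "cball c \<rho>" U])
  have cont\<gamma>: "continuous_on {0..2 * pi} (\<lambda>t. \<psi> (?u (?\<gamma> t)))"
    by (rule continuous_on_compose2[OF cont]) (auto intro!: continuous_intros simp: \<gamma>)
  show int: "(\<lambda>t. \<psi> (?u (?\<gamma> t))) absolutely_integrable_on {0..2 * pi}"
    using cont\<gamma> by (rule absolutely_integrable_continuous_real)
  have c: "c \<in> U" using * by auto
  let ?l = "\<lambda>\<zeta>. of_real (\<psi> (?u c)) +
    of_real (2 * \<psi>' (?u c)) * (\<Sum>i\<in>I. cnj (g i c) * (g i \<zeta> - g i c))"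
  have "?l holomorphic_on cball c \<rho>"
    using * by (intro holomorphic_intros holomorphic_on_subset[OF hol]) auto
  from circle_mean_holomorphic[OF this]
  have "((\<lambda>t. ?l (?\<gamma> t)) has_integral (2 * pi * \<psi> (?u c))) {0..2 * pi}"
    using * by simp
  from has_integral_linear[OF this bounded_linear_Re]
  have "((\<lambda>t. Re (?l (?\<gamma> t))) has_integral (2 * pi * \<psi> (?u c))) {0..2 * pi}"
    by (simp add: o_def)
  then have "2 * pi * \<psi> (?u c) \<le> integral {0..2 * pi} (\<lambda>t. \<psi> (?u (?\<gamma> t)))"
  proof (rule has_integral_le)
    show "((\<lambda>t. \<psi> (?u (?\<gamma> t))) has_integral integral {0..2 * pi} (\<lambda>t. \<psi> (?u (?\<gamma> t)))) {0..2 * pi}"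
      using int set_lebesgue_integral_eq_integral(1) by blast
    fix t :: real
    let ?z = "?\<gamma> t"
    have "2 * Re (cnj (g i c) * (g i ?z - g i c)) \<le> (norm (g i ?z))\<^sup>2 - (norm (g i c))\<^sup>2" for i
    proof -
      have "0 \<le> (Re (g i ?z) - Re (g i c))\<^sup>2 + (Im (g i ?z) - Im (g i c))\<^sup>2" by simp
      then show ?thesis
        by (simp only: cmod_power2) (simp add: power2_eq_square algebra_simps)
    qed
    then have "(\<Sum>i\<in>I. 2 * Re (cnj (g i c) * (g i ?z - g i c))) \<le> (\<Sum>i\<in>I. (norm (g i ?z))\<^sup>2 - (norm (g i c))\<^sup>2)"
      by (rule sum_mono)
    then have "2 * Re (\<Sum>i\<in>I. cnj (g i c) * (g i ?z - g i c)) \<le> ?u ?z - ?u c"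
      by (simp only: sum_distrib_left[symmetric] Re_sum[symmetric] sum_subtractf)
    then have "\<psi>' (?u c) * (2 * Re (\<Sum>i\<in>I. cnj (g i c) * (g i ?z - g i c))) \<le> \<psi>' (?u c) * (?u ?z - ?u c)"
      by (rule mult_left_mono) (use mono S c in auto)
    moreover have "Re (?l ?z) = \<psi> (?u c) + \<psi>' (?u c) * (2 * Re (\<Sum>i\<in>I. cnj (g i c) * (g i ?z - g i c)))"
      by (simp only: plus_complex.sel Re_complex_of_real times_complex.sel Im_complex_of_real)
    ultimately show "Re (?l ?z) \<le> \<psi> (?u ?z)"
      using tangent[OF S[OF c] S[OF \<gamma>[of t]]] by linarith
  qed
  then show "\<psi> (?u c) \<le> 1 / (2 * pi) * integral {0..2 * pi} (\<lambda>t. \<psi> (?u (?\<gamma> t)))"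
    by (simp add: field_simps)
qed

lemma convex_on_imp_tangent_le:
  assumes "convex_on S f" and "x \<in> S" "y \<in> S" and "(f has_real_derivative d) (at x)"
  shows "f x + d * (y - x) \<le> f y"
proof -
  have "((\<lambda>t. f (x + t * (y - x))) has_real_derivative d * (y - x)) (at 0)"
    using assms(4) by (auto intro!: derivative_eq_intros DERIV_chain2[where f = f])
  then have "((\<lambda>t. (f (x + t * (y - x)) - f x) / t) \<longlongrightarrow> d * (y - x)) (at_right 0)"
    by (simp add: has_field_derivative_iff filterlim_at_split)
  moreover have "\<forall>\<^sub>F t in at_right 0. (f (x + t * (y - x)) - f x) / t \<le> f y - f x"
    unfolding eventually_at_right_field
  proof (intro exI[of _ 1] conjI allI impI)
    fix t :: real
    assume t: "0 < t" "t < 1"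
    have "f ((1 - t) *\<^sub>R x + t *\<^sub>R y) \<le> (1 - t) * f x + t * f y"
      using convex_onD[OF assms(1), of t x y] t assms by simp
    moreover have "(1 - t) *\<^sub>R x + t *\<^sub>R y = x + t * (y - x)"
      by (simp add: algebra_simps)
    ultimately have "f (x + t * (y - x)) - f x \<le> (f y - f x) * t"
      by (simp add: algebra_simps)
    then show "(f (x + t * (y - x)) - f x) / t \<le> f y - f x"
      using t by (simp add: pos_divide_le_eq)
  qed simp
  ultimately have "d * (y - x) \<le> f y - f x"
    by (intro tendsto_upperbound) auto
  then show ?thesis by simp
qed

lemma flat_tangent_le:
  assumes "A > 0" "x \<le> A / 2" "y \<le> A / 2"
  shows "flat A 0 x + A * flat A 2 x * (y - x) \<le> flat A 0 y"
  using convex_on_imp_tangent_le[OF convex_on_flat[OF assms(1)], of x y] assms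
    flat_deriv[OF assms(1), of 0 x] by (simp add: eval_nat_numeral)

subsection \<open>Complex differentials and the Levi form\<close>

definition has_complex_differential ::
    "(complex ^ 'n::finite \<Rightarrow> complex) \<Rightarrow> (complex ^ 'n \<Rightarrow> complex) \<Rightarrow> complex ^ 'n \<Rightarrow> bool" where
  "has_complex_differential f D z \<longleftrightarrow>
     (f has_derivative D) (at z) \<and> (\<forall>c v. D (c *s v) = c * D v)"

lemma has_complex_differential_const: "has_complex_differential (\<lambda>z. c) (\<lambda>v. 0) z"
  by (simp add: has_complex_differential_def)

lemma has_complex_differential_add:
  assumes "has_complex_differential f D z" "has_complex_differential g E z"
  shows "has_complex_differential (\<lambda>z. f z + g z) (\<lambda>v. D v + E v) z"
  using assms by (auto simp: has_complex_differential_def algebra_simps intro!: has_derivative_add)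

lemma has_complex_differential_mult:
  assumes "has_complex_differential f D z" "has_complex_differential g E z"
  shows "has_complex_differential (\<lambda>z. f z * g z) (\<lambda>v. f z * E v + D v * g z) z"
  using has_derivative_mult[of f D z UNIV g E] assms
  by (simp add: has_complex_differential_def algebra_simps)

lemma has_complex_differential_inverse:
  assumes "has_complex_differential f D z" "f z \<noteq> 0"
  shows "has_complex_differential (\<lambda>z. inverse (f z)) (\<lambda>v. - (inverse (f z) * D v * inverse (f z))) z"
  using Deriv.has_derivative_inverse[of f z D UNIV] assms
  by (simp add: has_complex_differential_def algebra_simps)

lemma has_complex_differential_sum:
  assumes "\<And>i. i \<in> I \<Longrightarrow> has_complex_differential (f i) (D i) z"
  shows "has_complex_differential (\<lambda>z. \<Sum>i\<in>I. f i z) (\<lambda>v. \<Sum>i\<in>I. D i v) z"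
  using assms
  by (auto simp: has_complex_differential_def sum_distrib_left intro!: has_derivative_sum sum.cong)

lemma has_complex_differential_nth: "has_complex_differential (\<lambda>z. z $ k) (\<lambda>v. v $ k) z"
  by (simp add: has_complex_differential_def bounded_linear_imp_has_derivative bounded_linear_vec_nth)

lemma bounded_linear_vector_scalar_mult: "bounded_linear (\<lambda>\<zeta>::complex. \<zeta> *s v)"
  by (rule linear_conv_bounded_linear[THEN iffD1])
    (auto intro!: linearI simp: vec_eq_iff algebra_simps)

lemma has_complex_differential_line:
  assumes "has_complex_differential f D (p + \<zeta> *s v)"
  shows "((\<lambda>\<zeta>. f (p + \<zeta> *s v)) has_field_derivative D v) (at \<zeta>)"
proof -
  have "((\<lambda>\<zeta>. p + \<zeta> *s v) has_derivative (\<lambda>\<zeta>. \<zeta> *s v)) (at \<zeta>)"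
    by (auto intro!: derivative_eq_intros bounded_linear_imp_has_derivative
        bounded_linear_vector_scalar_mult)
  from has_derivative_compose[OF this, of f D] assms
  show ?thesis
    by (simp add: has_complex_differential_def has_field_derivative_def mult_commute_abs)
qed

lemma norm_std_basis: "norm (std_basis k) = 1"
  by (simp add: norm_eq_sqrt_inner inner_axis_axis)

lemma axis_ii: "axis k \<i> = \<i> *s axis k 1"
  by (simp add: vec_eq_iff axis_def)

lemma d_z_eq: "(f has_derivative D) (at z) \<Longrightarrow> d_z j f z = (D (axis j 1) - \<i> * D (axis j \<i>)) / 2"
  by (simp add: d_z_def frechet_derivative_at[symmetric])

lemma d_zbar_eq: "(f has_derivative D) (at z) \<Longrightarrow> d_zbar j f z = (D (axis j 1) + \<i> * D (axis j \<i>)) / 2"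
  by (simp add: d_zbar_def frechet_derivative_at[symmetric])

lemma complex_differential_expand:
  assumes "has_complex_differential f D z"
  shows "D v = (\<Sum>k\<in>UNIV. D (axis k 1) * v $ k)"
proof -
  have lin: "linear D"
    using assms by (auto simp: has_complex_differential_def has_derivative_linear)
  have "D v = D (\<Sum>k\<in>UNIV. v $ k *s axis k 1)"
    by (simp add: basis_expansion)
  also have "\<dots> = (\<Sum>k\<in>UNIV. D (v $ k *s axis k 1))"
    using lin by (rule linear_sum)
  finally show ?thesis using assms by (simp add: has_complex_differential_def mult.commute)
qed

text \<open>The factor 2 is the value of \<open>i dz \<and> d\<close>-zbar at \<open>(v, iv)\<close> for a unit vector \<open>v\<close>.\<close>

lemma i_ddbar_comp_sum_squares:
  fixes G :: "'i \<Rightarrow> complex ^ 'n::finite \<Rightarrow> complex" and \<psi> \<psi>' :: "real \<Rightarrow> real"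
  assumes "open \<Omega>" "z \<in> \<Omega>"
    and G: "\<And>i w. i \<in> I \<Longrightarrow> w \<in> \<Omega> \<Longrightarrow> has_complex_differential (G i) (D i w) w"
    and D: "\<And>i v. i \<in> I \<Longrightarrow> \<exists>E. has_complex_differential (\<lambda>w. D i w v) E z"
    and \<psi>: "\<And>t. (\<psi> has_real_derivative \<psi>' t) (at t)"
    and \<psi>': "\<And>t. (\<psi>' has_real_derivative \<psi>'' t) (at t)"
  shows "Re (i_ddbar (\<lambda>w. \<psi> (\<Sum>i\<in>I. (norm (G i w))\<^sup>2)) z v (\<i> *s v)) =
    2 * \<psi>'' (\<Sum>i\<in>I. (norm (G i z))\<^sup>2) * (norm (\<Sum>i\<in>I. cnj (G i z) * D i z v))\<^sup>2 +
    2 * \<psi>' (\<Sum>i\<in>I. (norm (G i z))\<^sup>2) * (\<Sum>i\<in>I. (norm (D i z v))\<^sup>2)"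
proof -
  define u where "u = (\<lambda>w. \<Sum>i\<in>I. (norm (G i w))\<^sup>2)"
  define q where "q = (\<lambda>w v. \<Sum>i\<in>I. cnj (G i w) * D i w v)"
  have du: "(u has_derivative (\<lambda>v. 2 * Re (q w v))) (at w)" if "w \<in> \<Omega>" for w
  proof -
    have "((\<lambda>w. \<Sum>i\<in>I. G i w \<bullet> G i w) has_derivative (\<lambda>v. \<Sum>i\<in>I. G i w \<bullet> D i w v + D i w v \<bullet> G i w)) (at w)"
      using G[OF _ that] by (intro has_derivative_sum has_derivative_inner) (auto simp: has_complex_differential_def)
    moreover have "(\<lambda>w. \<Sum>i\<in>I. G i w \<bullet> G i w) = u"
      by (simp add: u_def power2_norm_eq_inner)
    moreover have "(\<Sum>i\<in>I. G i w \<bullet> D i w v + D i w v \<bullet> G i w) = 2 * Re (q w v)" for v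
      by (simp add: q_def Re_sum sum_distrib_left inner_complex_def algebra_simps)
    ultimately show ?thesis by simp
  qed
  have q_lin: "q w (c *s v) = c * q w v" if "w \<in> \<Omega>" for c w v
    using G[OF _ that] by (auto simp: q_def has_complex_differential_def sum_distrib_left algebra_simps intro!: sum.cong)
  have dchi: "((\<lambda>w. complex_of_real (\<phi> (u w))) has_derivative
      (\<lambda>v. of_real (\<phi>' (u w)) * of_real (2 * Re (q w v)))) (at w)"
    if "w \<in> \<Omega>" "\<And>t. (\<phi> has_real_derivative \<phi>' t) (at t)" for \<phi> \<phi>' :: "real \<Rightarrow> real" and w
    using has_derivative_compose[OF has_derivative_compose[OF du[OF that(1)]
        that(2)[unfolded has_field_derivative_def]] bounded_linear_imp_has_derivative[OF bounded_linear_of_real]]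
    by simp
  have wirtinger: "(b * of_real (2 * Re a) + \<i> * (b * of_real (2 * Re (\<i> * a)))) / 2 = b * cnj a"
    "(b * of_real (2 * Re a) * c - \<i> * (b * of_real (2 * Re (\<i> * a)) * c)) / 2 = b * a * c" for a b c :: complex
    by (simp_all add: complex_eq_iff field_simps)
  have first: "d_zbar k (\<lambda>w. complex_of_real (\<psi> (u w))) w = of_real (\<psi>' (u w)) * cnj (q w (axis k 1))"
    if "w \<in> \<Omega>" for k w
    unfolding d_zbar_eq[OF dchi[OF that \<psi>]] axis_ii q_lin[OF that] by (rule wirtinger)
  have second: "d_z j (d_zbar k (\<lambda>w. complex_of_real (\<psi> (u w)))) z =
      of_real (\<psi>'' (u z)) * q z (axis j 1) * cnj (q z (axis k 1)) +
      of_real (\<psi>' (u z)) * (\<Sum>i\<in>I. D i z (axis j 1) * cnj (D i z (axis k 1)))" for j k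
  proof -
    obtain E where E: "\<And>i. i \<in> I \<Longrightarrow> has_complex_differential (\<lambda>w. D i w (axis k 1)) (E i) z"
      using D[where v = "axis k 1"] by metis
    have cq: "((\<lambda>w. cnj (q w (axis k 1))) has_derivative
        (\<lambda>v. \<Sum>i\<in>I. G i z * cnj (E i v) + D i z v * cnj (D i z (axis k 1)))) (at z)"
      unfolding q_def cnj_sum complex_cnj_mult complex_cnj_cnj
      using E G[OF _ assms(2)]
      by (intro has_derivative_sum has_derivative_mult has_derivative_cnj) (auto simp: has_complex_differential_def)
    let ?T = "\<lambda>v. of_real (\<psi>' (u z)) * (\<Sum>i\<in>I. G i z * cnj (E i v) + D i z v * cnj (D i z (axis k 1)))
        + of_real (\<psi>'' (u z)) * of_real (2 * Re (q z v)) * cnj (q z (axis k 1))"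
    have "((\<lambda>w. of_real (\<psi>' (u w)) * cnj (q w (axis k 1))) has_derivative ?T) (at z)"
      by (rule has_derivative_mult[OF dchi[OF assms(2) \<psi>'] cq])
    then have "(d_zbar k (\<lambda>w. complex_of_real (\<psi> (u w))) has_derivative ?T) (at z)"
      by (rule has_derivative_transform_within_open[OF _ assms(1,2)]) (simp add: first)
    from d_z_eq[OF this]
    have T: "d_z j (d_zbar k (\<lambda>w. complex_of_real (\<psi> (u w)))) z = (?T (axis j 1) - \<i> * ?T (\<i> *s axis j 1)) / 2"
      unfolding axis_ii .
    have *: "E i (\<i> *s w) = \<i> * E i w" "D i z (\<i> *s w) = \<i> * D i z w" if "i \<in> I" for i w
      using E[OF that] G[OF that assms(2)] by (auto simp: has_complex_differential_def)
    have anti: "(\<Sum>i\<in>I. G i z * cnj (E i (\<i> *s w)) + D i z (\<i> *s w) * cnj (D i z (axis k 1))) =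
      \<i> * ((\<Sum>i\<in>I. D i z w * cnj (D i z (axis k 1))) - (\<Sum>i\<in>I. G i z * cnj (E i w)))" for w
      by (simp add: * sum_distrib_left right_diff_distrib sum_subtractf[symmetric] algebra_simps cong: sum.cong)
    have split: "(b * (g + d) + h * x * c - \<i> * (b * (\<i> * (d - g)) + h * y * c)) / 2 =
      (h * x * c - \<i> * (h * y * c)) / 2 + b * d" for b c d g h x y :: complex
      by (simp add: field_simps)
    show ?thesis
      unfolding T q_lin[OF assms(2)] anti unfolding sum.distrib split wirtinger ..
  qed
  have expand: "(\<Sum>j\<in>UNIV. \<Sum>k\<in>UNIV. (L (axis j 1) * cnj (L (axis k 1))) * (v $ j * cnj (v $ k)))
      = of_real ((norm (L v))\<^sup>2)"
    if "\<And>v. L v = (\<Sum>k\<in>UNIV. L (axis k 1) * v $ k)" for L :: "complex ^ 'n \<Rightarrow> complex"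
  proof -
    have "of_real ((norm (L v))\<^sup>2) = L v * cnj (L v)"
      by (rule complex_norm_square)
    also have "\<dots> = (\<Sum>k\<in>UNIV. L (axis k 1) * v $ k) * cnj (\<Sum>k\<in>UNIV. L (axis k 1) * v $ k)"
      using that[of v] by presburger
    finally show ?thesis by (simp add: sum_product mult_ac)
  qed
  have q_expand: "q z v = (\<Sum>k\<in>UNIV. q z (axis k 1) * v $ k)" for v
  proof -
    have "q z v = (\<Sum>i\<in>I. \<Sum>k\<in>UNIV. cnj (G i z) * D i z (axis k 1) * v $ k)"
      unfolding q_def using complex_differential_expand[OF G[OF _ assms(2)], of _ v]
      by (intro sum.cong) (auto simp: sum_distrib_left mult_ac)
    then show ?thesis
      by (subst (asm) sum.swap) (simp add: q_def sum_distrib_right)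
  qed
  have "i_ddbar (\<lambda>w. \<psi> (u w)) z v (\<i> *s v) =
    2 * (\<Sum>j\<in>UNIV. \<Sum>k\<in>UNIV. d_z j (d_zbar k (\<lambda>w. complex_of_real (\<psi> (u w)))) z * (v $ j * cnj (v $ k)))"
    unfolding i_ddbar_def sum_distrib_left by (intro sum.cong refl) (simp add: algebra_simps)
  also have "(\<Sum>j\<in>UNIV. \<Sum>k\<in>UNIV. d_z j (d_zbar k (\<lambda>w. complex_of_real (\<psi> (u w)))) z * (v $ j * cnj (v $ k))) =
    of_real (\<psi>'' (u z)) * (\<Sum>j\<in>UNIV. \<Sum>k\<in>UNIV. (q z (axis j 1) * cnj (q z (axis k 1))) * (v $ j * cnj (v $ k))) +
    of_real (\<psi>' (u z)) * (\<Sum>j\<in>UNIV. \<Sum>k\<in>UNIV. \<Sum>i\<in>I. (D i z (axis j 1) * cnj (D i z (axis k 1))) * (v $ j * cnj (v $ k)))"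
    unfolding second
    by (simp add: sum_distrib_left sum_distrib_right sum.distrib ring_distribs mult_ac)
  also have "(\<Sum>j\<in>UNIV. \<Sum>k\<in>UNIV. \<Sum>i\<in>I. (D i z (axis j 1) * cnj (D i z (axis k 1))) * (v $ j * cnj (v $ k))) =
    (\<Sum>i\<in>I. \<Sum>j\<in>UNIV. \<Sum>k\<in>UNIV. (D i z (axis j 1) * cnj (D i z (axis k 1))) * (v $ j * cnj (v $ k)))"
    by (subst sum.swap[of _ I], subst (2) sum.swap) (rule refl)
  also have "\<dots> = (\<Sum>i\<in>I. of_real ((norm (D i z v))\<^sup>2))"
    by (intro sum.cong refl expand complex_differential_expand[OF G[OF _ assms(2)]])
  also note expand[OF q_expand]
  finally show ?thesis
    by (simp add: u_def q_def of_real_sum[symmetric] del: of_real_sum of_real_power)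
qed

lemma levi_norm_square:
  fixes z v :: "complex ^ 'n::finite"
  shows "Re (i_ddbar (\<lambda>w. (norm w)\<^sup>2) z v (\<i> *s v)) = 2 * (norm v)\<^sup>2"
proof -
  have eq: "(norm w)\<^sup>2 = (\<Sum>k\<in>UNIV. (norm (w $ k))\<^sup>2)" for w :: "complex ^ 'n"
    by (simp add: norm_vec_def L2_set_def sum_nonneg)
  have "Re (i_ddbar (\<lambda>w :: complex ^ 'n. (\<Sum>k\<in>UNIV. (norm (w $ k))\<^sup>2)) z v (\<i> *s v)) =
      2 * 0 * (norm (\<Sum>k\<in>UNIV. cnj (z $ k) * v $ k))\<^sup>2 + 2 * 1 * (\<Sum>k\<in>UNIV. (norm (v $ k))\<^sup>2)"
    by (rule i_ddbar_comp_sum_squares[where \<Omega> = UNIV and \<psi> = "\<lambda>t. t" and \<psi>' = "\<lambda>t. 1" and \<psi>'' = "\<lambda>t. 0"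
          and G = "\<lambda>k w. w $ k" and D = "\<lambda>k w v. v $ k"])
      (auto intro: has_complex_differential_nth has_complex_differential_const)
  then show ?thesis by (simp add: eq)
qed

subsection \<open>Supporting hyperplanes\<close>

definition lin :: "complex ^ 'n::finite \<Rightarrow> complex ^ 'n \<Rightarrow> complex" where
  "lin c z = (\<Sum>k\<in>UNIV. c $ k * z $ k)"

lemma has_complex_differential_lin: "has_complex_differential (lin c) (lin c) z"
proof -
  have "has_complex_differential (\<lambda>z. \<Sum>k\<in>UNIV. c $ k * z $ k) (\<lambda>v. \<Sum>k\<in>UNIV. c $ k * v $ k + 0 * z $ k) z"
    by (intro has_complex_differential_sum has_complex_differential_mult
        has_complex_differential_const has_complex_differential_nth)
  then show ?thesis by (simp add: lin_def[abs_def])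
qed

lemma norm_lin_le:
  fixes B :: real
  assumes "\<And>k. norm (c $ k) \<le> B"
  shows "norm (lin c z) \<le> CARD('n) * B * norm (z :: complex ^ 'n::finite)"
proof -
  have "0 \<le> B" using assms norm_ge_zero order_trans by blast
  then have "norm (c $ k * z $ k) \<le> B * norm z" for k
    unfolding norm_mult by (intro mult_mono assms Finite_Cartesian_Product.norm_nth_le) auto
  then have "norm (lin c z) \<le> (\<Sum>k\<in>(UNIV :: 'n set). B * norm z)"
    unfolding lin_def by (intro order_trans[OF norm_sum] sum_mono)
  then show ?thesis by simp
qed

text \<open>
  The set \<open>lin c = c\<^sub>j\<close> is a complex hyperplane through \<open>e\<^sub>j + Span {e\<^sub>k | k > j}\<close> that misses \<open>\<Omega>\<close>; the
  disks in \<open>\<Omega>\<close> bound its coefficients.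
\<close>

lemma normalized_domain_functional:
  fixes \<Omega> :: "(complex ^ 'n::{finite,linorder}) set"
  assumes \<Omega>: "\<Omega> \<in> normalized_domains r" and r: "0 < r" "r \<le> 1"
  obtains c :: "(complex, 'n) vec" where "\<And>k. j < k \<Longrightarrow> c $ k = 0" "Re (c $ j) = 1"
    "\<And>k. norm (c $ k) \<le> 1 / r" "\<And>z. z \<in> \<Omega> \<Longrightarrow> Re (lin c z) < 1"
proof -
  let ?T = "(+) (std_basis j) ` vec.span (std_basis ` {j<..}) :: (complex, 'n) vec set"
  have dom: "open \<Omega>" "convex \<Omega>"
    using \<Omega> by (auto simp: normalized_domains_def C_properly_convex_def convex_domain_def)
  have disk: "\<zeta> *s std_basis k \<in> \<Omega>" if "norm \<zeta> < r" for k \<zeta>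
  proof (cases "k = first_index")
    case True
    have "\<zeta> / of_real r \<in> ball 0 1" using that r by (simp add: norm_divide)
    then have "(of_real r * (\<zeta> / of_real r)) *s std_basis first_index \<in> \<Omega>"
      using \<Omega> by (auto simp only: normalized_domains_def mem_Collect_eq)
    then show ?thesis using True r by simp
  next
    case False
    then show ?thesis using \<Omega> that r by (auto simp: normalized_domains_def)
  qed
  have zero: "0 \<in> \<Omega>" using disk[of 0] r by simp
  have scaleR: "t *\<^sub>R x = of_real t *s x" for t and x :: "(complex, 'n) vec"
    by (simp add: vec_eq_iff) (simp add: scaleR_conv_of_real)
  have "vec.subspace (vec.span (std_basis ` {j<..} :: (complex, 'n) vec set))" by simp
  then have "convex (vec.span (std_basis ` {j<..} :: (complex, 'n) vec set))"
    by (auto intro!: convexI simp: vec.subspace_def scaleR)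
  then have "convex ?T" by (rule convex_translation)
  moreover have "\<Omega> \<inter> ?T = {}"
    using \<Omega> by (simp add: normalized_domains_def Int_commute)
  moreover have "?T \<noteq> {}" "\<Omega> \<noteq> {}"
    using vec.span_zero zero by auto
  ultimately obtain a b where ab: "a \<noteq> 0" "\<And>x. x \<in> \<Omega> \<Longrightarrow> a \<bullet> x \<le> b" "\<And>x. x \<in> ?T \<Longrightarrow> b \<le> a \<bullet> x"
    using separating_hyperplane_sets[OF \<open>convex \<Omega>\<close>, of ?T] by blast
  have T: "std_basis j + v \<in> ?T" if "v \<in> vec.span (std_basis ` {j<..})" for v
    using that by simp
  have strict: "a \<bullet> x < b" if "x \<in> \<Omega>" for x
  proof -
    obtain e where e: "e > 0" "cball x e \<subseteq> \<Omega>"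
      using dom(1) \<open>x \<in> \<Omega>\<close> open_contains_cball by blast
    have "x + (e / norm a) *\<^sub>R a \<in> \<Omega>"
      using e \<open>a \<noteq> 0\<close> by (intro subsetD[OF e(2)]) (simp add: dist_norm)
    then have "a \<bullet> x + (e / norm a) * (a \<bullet> a) \<le> b"
      using ab(2)[of "x + (e / norm a) *\<^sub>R a"] by (simp add: inner_add_right)
    moreover have "(e / norm a) * (a \<bullet> a) > 0" using e \<open>a \<noteq> 0\<close> by simp
    ultimately show ?thesis by linarith
  qed
  have inner_basis: "a \<bullet> (\<zeta> *s axis k 1) = Re (cnj (a $ k) * \<zeta>)" for \<zeta> k
  proof -
    have "\<zeta> *s axis k 1 = axis k \<zeta>" by (simp add: vec_eq_iff axis_def)
    then show ?thesis by (simp add: inner_axis inner_complex_def)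
  qed
  have "std_basis j \<in> ?T" using T[OF vec.span_zero] by simp
  from ab(3)[OF this] have b_le: "b \<le> Re (a $ j)"
    using inner_basis[of 1 j] by simp
  have b_pos: "0 < b" using strict[OF zero] by simp
  define \<alpha> where "\<alpha> = Re (a $ j)"
  have \<alpha>: "\<alpha> > 0" "b \<le> \<alpha>" using b_le b_pos by (simp_all add: \<alpha>_def)
  have a0: "a $ k = 0" if "j < k" for k
  proof (rule ccontr)
    assume nz: "a $ k \<noteq> 0"
    define t where "t = (\<alpha> - b + 1) / (norm (a $ k))\<^sup>2"
    have "(- of_real t * a $ k) *s std_basis k \<in> vec.span (std_basis ` {j<..})"
      using that by (intro vec.span_scale vec.span_base) auto
    from ab(3)[OF T[OF this]]
    have "b \<le> \<alpha> + Re (cnj (a $ k) * (- of_real t * a $ k))"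
      using inner_basis[of 1 j] unfolding inner_add_right inner_basis[of "- of_real t * a $ k"]
      by (simp add: \<alpha>_def)
    also have "Re (cnj (a $ k) * (- of_real t * a $ k)) = - (t * (norm (a $ k))\<^sup>2)"
      unfolding cmod_power2 by (simp add: power2_eq_square algebra_simps)
    also have "t * (norm (a $ k))\<^sup>2 = \<alpha> - b + 1"
      using nz by (simp add: t_def)
    finally show False by simp
  qed
  define c where "c = (\<chi> k. cnj (a $ k) / of_real \<alpha>)"
  have lin_c: "Re (lin c z) = (a \<bullet> z) / \<alpha>" for z
    by (simp add: lin_def c_def inner_vec_def inner_complex_def Re_sum sum_divide_distrib
        add_divide_distrib)
  show ?thesis
  proof (rule that[of c])
    show "c $ k = 0" if "j < k" for k using a0[OF that] by (simp add: c_def)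
    show "Re (c $ j) = 1" using \<alpha> by (simp add: c_def \<alpha>_def)
    show less_1: "Re (lin c z) < 1" if "z \<in> \<Omega>" for z
      using strict[OF that] \<alpha> by (simp add: lin_c)
    show "norm (c $ k) \<le> 1 / r" for k
    proof (rule ccontr)
      assume "\<not> ?thesis"
      then have gt: "norm (c $ k) > 1 / r" by simp
      then have nz: "c $ k \<noteq> 0" using r by (auto simp: field_simps)
      have "norm (inverse (c $ k)) < r"
        using gt r nz by (simp add: field_simps norm_divide)
      from less_1[OF disk[OF this, of k]]
      have "Re (c $ k * inverse (c $ k)) < 1"
        by (simp add: lin_def axis_def if_distrib[of "(*) _"] cong: if_cong)
      then show False using nz by simp
    qed
  qed
qed

lemma triangular_bound:
  fixes c :: "'n::{finite,linorder} \<Rightarrow> (complex, 'n) vec" and B M :: real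
  assumes upper: "\<And>j k. j < k \<Longrightarrow> c j $ k = 0" and diag: "\<And>j. Re (c j $ j) = 1"
    and bound: "\<And>j k. norm (c j $ k) \<le> B" and M: "\<And>j. norm (lin (c j) v) \<le> M"
  shows "norm v \<le> CARD('n) * (1 + CARD('n) * B) ^ CARD('n) * M"
proof -
  let ?d = "real CARD('n)"
  define q where "q = 1 + ?d * B"
  have B: "0 \<le> B" using bound norm_ge_zero order_trans by blast
  then have q: "1 \<le> q" by (simp add: q_def)
  have M0: "0 \<le> M" using M norm_ge_zero order_trans by blast
  have comp: "norm (v $ j) \<le> M * q ^ card {..<j}" for j
  proof (induction "card {..<j}" arbitrary: j rule: less_induct)
    case less
    have IH: "norm (v $ k) \<le> M * q ^ (card {..<j} - 1)" if "k < j" for k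
    proof -
      have "card {..<k} < card {..<j}"
        using that by (intro psubset_card_mono) auto
      then have "norm (v $ k) \<le> M * q ^ card {..<k}" "card {..<k} \<le> card {..<j} - 1"
        using less[of k] by auto
      then show ?thesis
        using q M0 by (meson mult_left_mono order_trans power_increasing)
    qed
    have "lin (c j) v = (\<Sum>k\<in>insert j {..<j}. c j $ k * v $ k)"
      unfolding lin_def using upper by (intro sum.mono_neutral_right) (auto simp: not_less_iff_gr_or_eq)
    then have eq: "c j $ j * v $ j = lin (c j) v - (\<Sum>k<j. c j $ k * v $ k)"
      by simp
    have "norm (v $ j) \<le> norm (c j $ j) * norm (v $ j)"
      using complex_Re_le_cmod[of "c j $ j"] diag[of j] by (simp add: mult_le_cancel_right1)
    also have "\<dots> \<le> M + norm (\<Sum>k<j. c j $ k * v $ k)"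
      unfolding norm_mult[symmetric] eq by (intro order_trans[OF norm_triangle_ineq4] add_right_mono M)
    finally have 1: "norm (v $ j) \<le> M + norm (\<Sum>k<j. c j $ k * v $ k)" .
    show ?case
    proof (cases "{..<j} = {}")
      case True
      then show ?thesis using 1 by simp
    next
      case False
      then obtain m where m: "card {..<j} = Suc m"
        by (metis card_0_eq finite not0_implies_Suc)
      have "norm (\<Sum>k<j. c j $ k * v $ k) \<le> (\<Sum>k<j. B * (M * q ^ m))"
        using IH m by (intro order_trans[OF norm_sum] sum_mono) (auto simp: norm_mult intro!: mult_mono bound B)
      also have "\<dots> \<le> ?d * (B * (M * q ^ m))"
        using B M0 q card_mono[of UNIV "{..<j}"] by (auto intro!: mult_right_mono)
      finally have "norm (v $ j) \<le> M * 1 + ?d * (B * (M * q ^ m))"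
        using 1 by simp
      also have "\<dots> \<le> M * q ^ m + ?d * (B * (M * q ^ m))"
        using M0 q by (intro add_right_mono mult_left_mono one_le_power)
      finally show ?thesis by (simp add: m q_def algebra_simps)
    qed
  qed
  have "norm v \<le> (\<Sum>j\<in>UNIV. norm (v $ j))"
    unfolding norm_vec_def by (rule L2_set_le_sum) simp
  also have "\<dots> \<le> (\<Sum>j\<in>(UNIV :: 'n set). M * q ^ CARD('n))"
  proof (intro sum_mono order_trans[OF comp] mult_left_mono power_increasing)
    show "card {..<j} \<le> CARD('n)" for j :: 'n by (rule card_mono) auto
  qed (use q M0 in auto)
  finally show ?thesis by (simp add: q_def mult_ac)
qed

subsection \<open>The plurisubharmonic function\<close>

locale half_spaces =
  fixes \<Omega> :: "(complex ^ 'n::{finite,linorder}) set" and c :: "'n \<Rightarrow> (complex, 'n) vec" and B :: real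
  assumes open_\<Omega>: "open \<Omega>"
    and upper: "\<And>j k. j < k \<Longrightarrow> c j $ k = 0" and diag: "\<And>j. Re (c j $ j) = 1"
    and bound: "\<And>j k. norm (c j $ k) \<le> B"
    and less_1: "\<And>j z. z \<in> \<Omega> \<Longrightarrow> Re (lin (c j) z) < 1"
begin

text \<open>
  \<open>1 / (2 - lin (c j))\<close> maps the half space \<open>Re (lin (c j)) < 1\<close> into the unit disk; the index \<open>None\<close>
  makes \<open>P\<close> itself one of the functions \<open>G i\<close>.
\<close>

definition functional :: "'n option \<Rightarrow> (complex, 'n) vec \<Rightarrow> complex" where
  "functional i v = (case i of None \<Rightarrow> 0 | Some j \<Rightarrow> lin (c j) v)"

definition h :: "'n option \<Rightarrow> (complex, 'n) vec \<Rightarrow> complex" where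
  "h i z = (case i of None \<Rightarrow> 1 | Some j \<Rightarrow> inverse (2 - lin (c j) z))"

definition P :: "(complex, 'n) vec \<Rightarrow> complex" where
  "P z = (\<Prod>j\<in>UNIV. h (Some j) z)"

definition dlogP :: "(complex, 'n) vec \<Rightarrow> (complex, 'n) vec \<Rightarrow> complex" where
  "dlogP z v = (\<Sum>j\<in>UNIV. h (Some j) z * lin (c j) v)"

definition G :: "'n option \<Rightarrow> (complex, 'n) vec \<Rightarrow> complex" where
  "G i z = P z * h i z"

definition dG :: "'n option \<Rightarrow> (complex, 'n) vec \<Rightarrow> (complex, 'n) vec \<Rightarrow> complex" where
  "dG i z v = P z * h i z * (dlogP z v + h i z * functional i v)"

definition u :: "(complex, 'n) vec \<Rightarrow> real" where
  "u z = (\<Sum>i\<in>UNIV. (norm (G i z))\<^sup>2)"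

lemma norm_ge_1: "z \<in> \<Omega> \<Longrightarrow> 1 \<le> norm (2 - lin (c j) z)"
  using less_1[of z j] complex_Re_le_cmod[of "2 - lin (c j) z"] by simp

lemma lin_neq_2: "z \<in> \<Omega> \<Longrightarrow> lin (c j) z \<noteq> 2"
  using less_1[of z j] by auto

lemma h_nonzero: "z \<in> \<Omega> \<Longrightarrow> h i z \<noteq> 0"
  using lin_neq_2[of z] by (auto simp: h_def split: option.split)

lemma norm_h_le_1: "z \<in> \<Omega> \<Longrightarrow> norm (h i z) \<le> 1"
  using norm_ge_1[of z] by (auto simp: h_def norm_inverse inverse_le_1_iff split: option.split)

lemma norm_P_le_h:
  assumes "z \<in> \<Omega>"
  shows "norm (P z) \<le> norm (h i z)"
proof -
  have 1: "norm (\<Prod>j\<in>J. h (Some j) z) \<le> 1" for J :: "'n set"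
    unfolding prod_norm[symmetric] using norm_h_le_1[OF assms] by (intro prod_le_1) auto
  show ?thesis
  proof (cases i)
    case None
    then show ?thesis using 1[of UNIV] by (simp add: h_def P_def)
  next
    case (Some j)
    have "P z = h (Some j) z * (\<Prod>j\<in>UNIV - {j}. h (Some j) z)"
      unfolding P_def by (rule prod.remove) auto
    then show ?thesis
      using 1[of "UNIV - {j}"] Some by (simp add: norm_mult mult_left_le)
  qed
qed

lemma P_nonzero: "z \<in> \<Omega> \<Longrightarrow> P z \<noteq> 0"
  by (simp add: P_def h_nonzero)

lemma diff_h:
  assumes "z \<in> \<Omega>"
  shows "has_complex_differential (h i) (\<lambda>v. (h i z)\<^sup>2 * functional i v) z"
proof (cases i)
  case None
  then show ?thesis
    using has_complex_differential_const[of 1 z] by (simp add: h_def[abs_def] functional_def)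
next
  case (Some j)
  have nz: "2 + (- 1) * lin (c j) z \<noteq> 0" using lin_neq_2[OF assms, of j] by simp
  have "has_complex_differential (\<lambda>z. 2 + (- 1) * lin (c j) z)
      (\<lambda>v. 0 + ((- 1) * lin (c j) v + 0 * lin (c j) z)) z"
    by (intro has_complex_differential_add has_complex_differential_mult
        has_complex_differential_const has_complex_differential_lin)
  from has_complex_differential_inverse[OF this nz] show ?thesis
    using Some by (simp add: h_def[abs_def] functional_def power2_eq_square mult_ac)
qed

lemma diff_P:
  assumes "z \<in> \<Omega>"
  shows "has_complex_differential P (\<lambda>v. P z * dlogP z v) z"
proof -
  have "has_complex_differential (\<lambda>z. \<Prod>j\<in>J. h (Some j) z)
      (\<lambda>v. (\<Prod>j\<in>J. h (Some j) z) * (\<Sum>j\<in>J. h (Some j) z * lin (c j) v)) z" if "finite J" for J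
    using that
  proof (induction J)
    case empty
    then show ?case by (simp add: has_complex_differential_const)
  next
    case (insert j J)
    from has_complex_differential_mult[OF diff_h[OF assms, of "Some j"] insert.IH] insert.hyps
    show ?case by (simp add: functional_def power2_eq_square algebra_simps)
  qed
  from this[of UNIV] show ?thesis by (simp add: P_def[abs_def] dlogP_def[abs_def])
qed

lemma diff_G:
  assumes "z \<in> \<Omega>"
  shows "has_complex_differential (G i) (dG i z) z"
  using has_complex_differential_mult[OF diff_P[OF assms] diff_h[OF assms, of i]]
  by (simp add: G_def[abs_def] dG_def[abs_def] power2_eq_square algebra_simps)

lemma diff_dG:
  assumes "z \<in> \<Omega>"
  shows "\<exists>E. has_complex_differential (\<lambda>w. dG i w v) E z"
proof -
  have "has_complex_differential (\<lambda>w. dlogP w v)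
      (\<lambda>x. \<Sum>j\<in>UNIV. h (Some j) z * 0 + (h (Some j) z)\<^sup>2 * functional (Some j) x * lin (c j) v) z"
    unfolding dlogP_def
    by (intro has_complex_differential_sum has_complex_differential_mult has_complex_differential_const
        diff_h[OF assms])
  note sum = has_complex_differential_add[OF this has_complex_differential_mult[OF diff_h[OF assms, of i]
        has_complex_differential_const[of "functional i v"]]]
  show ?thesis
    unfolding dG_def
    using has_complex_differential_mult[OF has_complex_differential_mult[OF diff_P[OF assms]
          diff_h[OF assms, of i]] sum]
    by blast
qed

lemma
  assumes "z \<in> \<Omega>"
  shows u_ge: "(norm (P z))\<^sup>2 \<le> u z" and u_le: "u z \<le> (1 + CARD('n)) * (norm (P z))\<^sup>2"
proof -
  have "(norm (G None z))\<^sup>2 \<le> u z"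
    unfolding u_def by (rule member_le_sum) auto
  then show "(norm (P z))\<^sup>2 \<le> u z" by (simp add: G_def h_def)
  have "(norm (G i z))\<^sup>2 \<le> (norm (P z))\<^sup>2" for i
    unfolding G_def norm_mult using norm_h_le_1[OF assms] by (intro power_mono mult_left_le) auto
  then have "u z \<le> (\<Sum>i\<in>(UNIV :: 'n option set). (norm (P z))\<^sup>2)"
    unfolding u_def by (rule sum_mono)
  then show "u z \<le> (1 + CARD('n)) * (norm (P z))\<^sup>2"
    by (simp add: card_UNIV_option)
qed

text \<open>Since \<open>h i = G i / G None\<close>, the differentials of the functions \<open>G i\<close> determine those of the \<open>h i\<close>.\<close>

lemma norm_le_dG:
  assumes "z \<in> \<Omega>"
  defines "K \<equiv> CARD('n) * (1 + CARD('n) * B) ^ CARD('n)"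
  shows "norm (P z) ^ 6 * (norm v)\<^sup>2 \<le> 2 * K\<^sup>2 * (\<Sum>i\<in>UNIV. (norm (dG i z v))\<^sup>2)"
proof -
  let ?S = "\<Sum>i\<in>UNIV. (norm (dG i z v))\<^sup>2"
  let ?p = "norm (P z)"
  have p: "?p > 0" using P_nonzero[OF assms(1)] by simp
  have S: "0 \<le> ?S" by (simp add: sum_nonneg)
  have "norm (lin (c j) v) \<le> sqrt (2 * ?S) / ?p ^ 3" for j
  proof -
    let ?h = "h (Some j) z"
    have "?p ^ 3 * norm (lin (c j) v) \<le> ?p * (norm ?h)\<^sup>2 * norm (lin (c j) v)"
      unfolding power3_eq_cube power2_eq_square mult.assoc
      by (intro mult_mono norm_P_le_h assms(1)) auto
    also have "\<dots> = norm (dG (Some j) z v - ?h * dG None z v)"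
    proof -
      have "dG (Some j) z v - ?h * dG None z v = P z * ?h\<^sup>2 * lin (c j) v"
        by (simp add: dG_def functional_def h_def power2_eq_square algebra_simps)
      then show ?thesis by (simp add: norm_mult norm_power)
    qed
    also have "\<dots> \<le> norm (dG (Some j) z v) + norm (dG None z v)"
      using norm_h_le_1[OF assms(1), of "Some j"]
      by (intro order_trans[OF norm_triangle_ineq4]) (simp add: norm_mult mult_left_le_one_le)
    also have "\<dots> \<le> sqrt (2 * ?S)"
    proof (rule real_le_rsqrt)
      have "(norm (dG (Some j) z v) + norm (dG None z v))\<^sup>2 \<le>
          2 * ((norm (dG (Some j) z v))\<^sup>2 + (norm (dG None z v))\<^sup>2)"
        using sum_squares_bound[of "norm (dG (Some j) z v)" "norm (dG None z v)"]
        by (simp add: power2_sum)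
      also have "(norm (dG (Some j) z v))\<^sup>2 + (norm (dG None z v))\<^sup>2 =
          (\<Sum>i\<in>{Some j, None}. (norm (dG i z v))\<^sup>2)" by simp
      also have "\<dots> \<le> ?S" by (rule sum_mono2) auto
      finally show "(norm (dG (Some j) z v) + norm (dG None z v))\<^sup>2 \<le> 2 * ?S" by simp
    qed
    finally show ?thesis using p by (simp add: pos_le_divide_eq mult.commute)
  qed
  from triangular_bound[OF upper diag bound this]
  have "norm v \<le> K * (sqrt (2 * ?S) / ?p ^ 3)" by (simp add: K_def)
  then have "?p ^ 3 * norm v \<le> K * sqrt (2 * ?S)"
    using p by (simp add: pos_le_divide_eq mult.commute)
  then have "(?p ^ 3 * norm v)\<^sup>2 \<le> (K * sqrt (2 * ?S))\<^sup>2"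
    by (rule power_mono) (use p in simp)
  then show ?thesis using S by (simp add: power_mult_distrib power_mult[symmetric])
qed

lemma C_k_on_G: "C_k_on n (G i) \<Omega>"
proof -
  have "C_k_on n (\<lambda>z. lin (c j) z) \<Omega>" for j
    using has_complex_differential_lin[of "c j"]
    by (intro C_k_on_bounded_linear open_\<Omega>)
      (auto simp: has_complex_differential_def dest: has_derivative_bounded_linear)
  then have "C_k_on n (\<lambda>z. 2 + (- 1) * lin (c j) z) \<Omega>" for j
    by (intro C_k_on_add C_k_on_mult C_k_on_const open_\<Omega>)
  then have "C_k_on n (\<lambda>z. inverse (2 + (- 1) * lin (c j) z)) \<Omega>" for j
    by (rule C_k_on_inverse[OF open_\<Omega>]) (simp add: lin_neq_2)
  then have h: "C_k_on n (h i) \<Omega>" for i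
    by (cases i) (simp_all add: h_def[abs_def] C_k_on_const open_\<Omega>)
  then show ?thesis
    unfolding G_def[abs_def] P_def by (intro C_k_on_mult C_k_on_prod open_\<Omega>)
qed

lemma C_k_on_u: "C_k_on n u \<Omega>"
  unfolding u_def[abs_def] power2_norm_eq_inner
  by (intro C_k_on_sum C_k_on_inner C_k_on_G open_\<Omega>)

definition cutoff :: "real \<Rightarrow> (complex, 'n) vec \<Rightarrow> real" where
  "cutoff s z = flat (2 * (1 + CARD('n))) 0 (u z - s)"

lemma u_le_card: "z \<in> \<Omega> \<Longrightarrow> u z \<le> 1 + CARD('n)"
  using u_le[of z] norm_P_le_h[of z None] mult_left_le[of "(norm (P z))\<^sup>2" "1 + real CARD('n)"]
    power_le_one[of "norm (P z)" 2]
  by (auto simp: h_def intro: order_trans)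

lemma cutoff_smooth: "C_infinity_on (cutoff s) \<Omega>"
proof -
  have "C_k_on n (\<lambda>z. u z + (- s)) \<Omega>" for n
    by (intro C_k_on_add C_k_on_u C_k_on_const open_\<Omega>)
  then show ?thesis
    unfolding C_infinity_on_def cutoff_def[abs_def] by (auto intro!: C_k_on_flat open_\<Omega> simp del: C_k_on.simps)
qed

lemma cutoff_deriv:
  defines "A \<equiv> real (2 * (1 + CARD('n)))"
  shows "((\<lambda>t. flat A 0 (t - s)) has_real_derivative A * flat A 2 (t - s)) (at t)"
    "((\<lambda>t. A * flat A 2 (t - s)) has_real_derivative A * (A * flat A 4 (t - s) - 2 * flat A 3 (t - s))) (at t)"
proof -
  have A: "A > 0" by (simp add: A_def)
  note chain = DERIV_chain2[OF flat_deriv[OF A], of "\<lambda>t. t - s" 1]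
  have d: "((\<lambda>t. t - s) has_real_derivative 1) (at t)"
    by (auto intro!: derivative_eq_intros)
  show "((\<lambda>t. flat A 0 (t - s)) has_real_derivative A * flat A 2 (t - s)) (at t)"
    using chain[OF d, of 0] by (simp add: eval_nat_numeral)
  show "((\<lambda>t. A * flat A 2 (t - s)) has_real_derivative A * (A * flat A 4 (t - s) - 2 * flat A 3 (t - s))) (at t)"
    using DERIV_cmult[OF chain[OF d, of 2], of A] by (simp add: numeral_eq_Suc)
qed

lemma cutoff_plurisubharmonic:
  assumes "s > 0"
  shows "plurisubharmonic_on \<Omega> (cutoff s)"
  unfolding plurisubharmonic_on_def
proof (intro conjI allI)
  let ?A = "real (2 * (1 + CARD('n)))"
  have A: "?A > 0" by simp
  have cont: "continuous_on \<Omega> (cutoff s)"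
    using cutoff_smooth C_k_on.simps(1) unfolding C_infinity_on_def by blast
  then show "upper_semicontinuous_on \<Omega> (cutoff s)"
    by (rule continuous_on_imp_usc)
  fix p v
  let ?U = "{\<zeta>. p + \<zeta> *s v \<in> \<Omega>}"
  have line: "continuous_on UNIV (\<lambda>\<zeta>. p + \<zeta> *s v)"
    by (intro continuous_intros linear_continuous_on bounded_linear_vector_scalar_mult)
  have "open ?U"
    using open_vimage[OF open_\<Omega> line] by (simp add: vimage_def)
  then have "subharmonic_on ?U (\<lambda>\<zeta>. flat ?A 0 ((\<Sum>i\<in>UNIV. (norm (G i (p + \<zeta> *s v)))\<^sup>2) - s))"
  proof (rule subharmonic_on_convex_sum_squares[where S = "{..?A / 2 + s}" and \<psi> = "\<lambda>t. flat ?A 0 (t - s)"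
        and \<psi>' = "\<lambda>t. ?A * flat ?A 2 (t - s)"])
    show "(\<lambda>\<zeta>. G i (p + \<zeta> *s v)) holomorphic_on ?U" for i
      unfolding holomorphic_on_def field_differentiable_def
      using has_complex_differential_line[OF diff_G] has_field_derivative_at_within by blast
    show "continuous_on ?U (\<lambda>\<zeta>. flat ?A 0 ((\<Sum>i\<in>UNIV. (norm (G i (p + \<zeta> *s v)))\<^sup>2) - s))"
      using continuous_on_compose2[OF cont continuous_on_subset[OF line], of ?U]
      by (auto simp: cutoff_def u_def)
    show "(\<Sum>i\<in>UNIV. (norm (G i (p + \<zeta> *s v)))\<^sup>2) \<in> {..?A / 2 + s}" if "\<zeta> \<in> ?U" for \<zeta>
      using u_le_card[of "p + \<zeta> *s v"] that assms by (simp add: u_def add_divide_distrib)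
    show "flat ?A 0 (x - s) + ?A * flat ?A 2 (x - s) * (y - x) \<le> flat ?A 0 (y - s)"
      if "x \<in> {..?A / 2 + s}" "y \<in> {..?A / 2 + s}" for x y
    proof -
      have "x - s \<le> ?A / 2" "y - s \<le> ?A / 2" using that by (simp_all only: atMost_iff diff_le_eq)
      from flat_tangent_le[OF A this] show ?thesis by simp
    qed
  qed (simp add: flat_nonneg)
  then show "subharmonic_on ?U (\<lambda>\<zeta>. cutoff s (p + \<zeta> *s v))"
    by (simp add: cutoff_def u_def)
qed

lemma cutoff_levi:
  fixes s p :: real
  defines "K \<equiv> CARD('n) * (1 + CARD('n) * B) ^ CARD('n)"
    and "A \<equiv> real (2 * (1 + CARD('n)))"
  assumes z: "z \<in> \<Omega>" and p: "0 < p" "p \<le> norm (P z)" and s: "s = p\<^sup>2 / 2"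
  shows "A * (exp (- A * inverse s) * (2 / A)\<^sup>2) * p ^ 6 * (norm v)\<^sup>2 \<le> K\<^sup>2 * Re (i_ddbar (cutoff s) z v (\<i> *s v))"
proof -
  let ?S = "\<Sum>i\<in>UNIV. (norm (dG i z v))\<^sup>2"
  let ?t = "u z - s"
  have A: "A > 0" by (simp add: A_def)
  have s0: "s > 0" using p(1) s zero_less_power[OF p(1), of 2] by linarith
  have "p\<^sup>2 \<le> u z"
    using power_mono[OF p(2), of 2] p(1) u_ge[OF z] by linarith
  then have t: "s \<le> ?t" "0 < ?t" using s s0 by auto
  have t_le: "?t \<le> A / 2" using u_le_card[OF z] s0 by (simp add: A_def)
  have flat2: "exp (- A * inverse s) * (2 / A)\<^sup>2 \<le> flat A 2 ?t"
  proof -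
    have "2 / A \<le> inverse ?t" using t t_le A by (simp add: field_simps)
    then have "(2 / A)\<^sup>2 \<le> (inverse ?t)\<^sup>2" using A by (intro power_mono) auto
    moreover have "A * inverse ?t \<le> A * inverse s"
      using A t s0 by (intro mult_left_mono le_imp_inverse_le) auto
    ultimately show ?thesis using t by (auto simp: flat_def intro!: mult_mono)
  qed
  have second: "0 \<le> A * (A * flat A 4 ?t - 2 * flat A 3 ?t)"
    using A t_le by (rule flat_second_deriv_nonneg)
  have "cutoff s = (\<lambda>w. flat A 0 ((\<Sum>i\<in>UNIV. (norm (G i w))\<^sup>2) - s))"
    by (auto simp: cutoff_def A_def u_def)
  then have "Re (i_ddbar (cutoff s) z v (\<i> *s v)) =
      2 * (A * (A * flat A 4 ?t - 2 * flat A 3 ?t)) * (norm (\<Sum>i\<in>UNIV. cnj (G i z) * dG i z v))\<^sup>2 +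
      2 * (A * flat A 2 ?t) * ?S"
    using i_ddbar_comp_sum_squares[where I = UNIV and G = G and D = dG and \<psi> = "\<lambda>t. flat A 0 (t - s)" and v = v,
        OF open_\<Omega> z diff_G diff_dG[OF z] cutoff_deriv[folded A_def]]
    by (simp add: u_def)
  then have "2 * (A * flat A 2 ?t) * ?S \<le> Re (i_ddbar (cutoff s) z v (\<i> *s v))"
    using second by simp
  moreover have "2 * (A * (exp (- A * inverse s) * (2 / A)\<^sup>2)) * ?S \<le> 2 * (A * flat A 2 ?t) * ?S"
    using A flat2 by (intro mult_right_mono mult_left_mono sum_nonneg) auto
  ultimately have levi: "2 * (A * (exp (- A * inverse s) * (2 / A)\<^sup>2)) * ?S \<le> Re (i_ddbar (cutoff s) z v (\<i> *s v))"
    by linarith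
  have "p ^ 6 * (norm v)\<^sup>2 \<le> norm (P z) ^ 6 * (norm v)\<^sup>2"
    using p by (intro mult_right_mono power_mono) auto
  also have "\<dots> \<le> 2 * K\<^sup>2 * ?S"
    unfolding K_def by (rule norm_le_dG[OF z])
  finally have "A * (exp (- A * inverse s) * (2 / A)\<^sup>2) * (p ^ 6 * (norm v)\<^sup>2) \<le>
      A * (exp (- A * inverse s) * (2 / A)\<^sup>2) * (2 * K\<^sup>2 * ?S)"
    using A by (intro mult_left_mono) auto
  also have "\<dots> = K\<^sup>2 * (2 * (A * (exp (- A * inverse s) * (2 / A)\<^sup>2)) * ?S)"
    by (simp only: mult_ac)
  also have "\<dots> \<le> K\<^sup>2 * Re (i_ddbar (cutoff s) z v (\<i> *s v))"
    using levi by (rule mult_left_mono) simp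
  finally show ?thesis by (simp only: mult.assoc)
qed

lemma norm_P_ge:
  assumes "z \<in> \<Omega>" "norm z \<le> a"
  shows "inverse (2 + CARD('n) * B * a) ^ CARD('n) \<le> norm (P z)"
proof -
  have B: "0 \<le> B" using bound norm_ge_zero order_trans by blast
  have "norm (2 - lin (c j) z) \<le> 2 + CARD('n) * B * a" for j
  proof -
    have "norm (2 - lin (c j) z) \<le> 2 + norm (lin (c j) z)"
      using norm_triangle_ineq4[of 2 "lin (c j) z"] by simp
    also have "norm (lin (c j) z) \<le> CARD('n) * B * norm z"
      by (rule norm_lin_le[OF bound])
    also have "\<dots> \<le> CARD('n) * B * a"
      using assms(2) B by (intro mult_left_mono) auto
    finally show ?thesis by simp
  qed
  then have "inverse (2 + CARD('n) * B * a) \<le> norm (h (Some j) z)" for j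
    using norm_ge_1[OF assms(1), of j]
    by (auto simp: h_def norm_inverse intro!: le_imp_inverse_le order.strict_trans2[OF zero_less_one])
  moreover have "0 \<le> 2 + CARD('n) * B * a"
    using assms(2) B by (intro add_nonneg_nonneg mult_nonneg_nonneg order_trans[OF norm_ge_zero assms(2)]) auto
  ultimately have "(\<Prod>j\<in>(UNIV :: 'n set). inverse (2 + CARD('n) * B * a)) \<le> (\<Prod>j\<in>UNIV. norm (h (Some j) z))"
    by (intro prod_mono) auto
  then show ?thesis by (simp add: P_def prod_norm)
qed

lemma cutoff_support:
  assumes z: "z \<in> \<Omega>" "cutoff s z \<noteq> 0" and "s > 0"
  shows "norm z \<le> CARD('n) * (1 + CARD('n) * B) ^ CARD('n) * (2 + inverse (sqrt (s / (1 + real CARD('n)))))"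
proof -
  let ?q = "sqrt (s / (1 + real CARD('n)))"
  have q: "?q > 0" using assms(3) by (simp add: add_pos_pos)
  have "s \<le> u z" using z(2) by (auto simp: cutoff_def flat_def split: if_splits)
  also have "\<dots> \<le> (1 + CARD('n)) * (norm (P z))\<^sup>2" by (rule u_le[OF z(1)])
  finally have "s / (1 + real CARD('n)) \<le> (norm (P z))\<^sup>2"
    by (simp add: field_simps)
  then have P: "?q \<le> norm (P z)" by (simp add: real_le_lsqrt)
  have "norm (lin (c j) z) \<le> 2 + inverse ?q" for j
  proof -
    have "?q \<le> inverse (norm (2 - lin (c j) z))"
      using order_trans[OF P norm_P_le_h[OF z(1), of "Some j"]] by (simp add: h_def norm_inverse)
    then have "norm (2 - lin (c j) z) \<le> inverse ?q"
      using q le_imp_inverse_le by fastforce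
    then show ?thesis
      using norm_triangle_ineq2[of "lin (c j) z" 2] by (simp add: norm_minus_commute)
  qed
  then show ?thesis using triangular_bound[OF upper diag bound] by simp
qed

end

theorem proposition13p1:
  fixes a r :: real
  assumes "a > 0" and "0 < r" and "r \<le> 1"
  shows "\<exists>C>0. \<exists>b>0. \<forall>\<Omega>\<in>normalized_domains r.
    \<exists>F :: complex ^ 'n::{finite,linorder} \<Rightarrow> real.
      F ` \<Omega> \<subseteq> {0..1} \<and>
      C_infinity_on F \<Omega> \<and>
      plurisubharmonic_on \<Omega> F \<and>
      (\<forall>z \<in> ball (std_basis first_index) a \<inter> \<Omega>.
         form_le (\<lambda>u v. complex_of_real C * i_ddbar (\<lambda>w. (norm w)\<^sup>2) z u v) (i_ddbar F z)) \<and>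
      (top_of_set \<Omega>) closure_of (support_on \<Omega> F) \<subseteq> ball (std_basis first_index) b \<inter> \<Omega>"
proof -
  let ?d = "real CARD('n)"
  let ?A = "real (2 * (1 + CARD('n)))"
  define B where "B = 1 / r"
  define K where "K = ?d * (1 + ?d * B) ^ CARD('n)"
  define p where "p = inverse (2 + ?d * B * (1 + a)) ^ CARD('n)"
  define s where "s = p\<^sup>2 / 2"
  define m where "m = ?A * (exp (- ?A * inverse s) * (2 / ?A)\<^sup>2) * p ^ 6"
  define C where "C = m / (2 * K\<^sup>2)"
  define R where "R = K * (2 + inverse (sqrt (s / (1 + ?d))))"
  have B: "B > 0" using assms by (simp add: B_def)
  have K: "K > 0" using B by (auto simp: K_def intro!: mult_pos_pos zero_less_power add_pos_nonneg)
  have p: "p > 0" using B assms unfolding p_def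
    by (intro zero_less_power positive_imp_inverse_positive add_pos_nonneg mult_nonneg_nonneg) auto
  have s: "s > 0" using p by (simp add: s_def)
  have m: "m > 0" using p by (simp add: m_def add_pos_nonneg)
  have C: "C > 0" using m K by (simp add: C_def)
  have R: "R > 0" using K s by (simp add: R_def add_pos_pos)
  have "\<exists>F :: (complex, 'n) vec \<Rightarrow> real.
      F ` \<Omega> \<subseteq> {0..1} \<and> C_infinity_on F \<Omega> \<and> plurisubharmonic_on \<Omega> F \<and>
      (\<forall>z \<in> ball (std_basis first_index) a \<inter> \<Omega>.
         form_le (\<lambda>u v. complex_of_real C * i_ddbar (\<lambda>w. (norm w)\<^sup>2) z u v) (i_ddbar F z)) \<and>
      (top_of_set \<Omega>) closure_of (support_on \<Omega> F) \<subseteq> ball (std_basis first_index) (R + 2) \<inter> \<Omega>"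
    if \<Omega>: "\<Omega> \<in> normalized_domains r" for \<Omega> :: "(complex, 'n) vec set"
  proof -
    have "\<exists>c :: (complex, 'n) vec. (\<forall>k>j. c $ k = 0) \<and> Re (c $ j) = 1 \<and> (\<forall>k. norm (c $ k) \<le> B) \<and>
        (\<forall>z\<in>\<Omega>. Re (lin c z) < 1)" for j
      using normalized_domain_functional[OF \<Omega> assms(2,3), of j] unfolding B_def by metis
    then obtain c where "\<And>j. (\<forall>k>j. c j $ k = 0) \<and> Re (c j $ j) = 1 \<and> (\<forall>k. norm (c j $ k) \<le> B) \<and>
        (\<forall>z\<in>\<Omega>. Re (lin (c j) z) < 1)" by metis
    moreover have "open \<Omega>"
      using \<Omega> by (auto simp: normalized_domains_def C_properly_convex_def convex_domain_def)
    ultimately interpret half_spaces \<Omega> c B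
      by unfold_locales auto
    show ?thesis
    proof (intro exI[of _ "cutoff s"] conjI ballI)
      show "cutoff s ` \<Omega> \<subseteq> {0..1}"
        by (auto simp: cutoff_def flat_nonneg intro!: flat_le_1)
      show "C_infinity_on (cutoff s) \<Omega>" by (rule cutoff_smooth)
      show "plurisubharmonic_on \<Omega> (cutoff s)" using s by (rule cutoff_plurisubharmonic)
    next
      fix z
      assume z: "z \<in> ball (std_basis first_index) a \<inter> \<Omega>"
      have "norm z \<le> 1 + a"
        using z norm_triangle_ineq2[of z "std_basis first_index"]
        by (simp add: dist_norm norm_minus_commute norm_std_basis)
      then have P: "p \<le> norm (P z)"
        unfolding p_def using z by (intro norm_P_ge) auto
      show "form_le (\<lambda>u v. complex_of_real C * i_ddbar (\<lambda>w. (norm w)\<^sup>2) z u v) (i_ddbar (cutoff s) z)"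
        unfolding form_le_def
      proof
        fix v
        have "m * (norm v)\<^sup>2 \<le> K\<^sup>2 * Re (i_ddbar (cutoff s) z v (\<i> *s v))"
          unfolding m_def K_def using z by (intro cutoff_levi p P s_def) auto
        then have "C * (2 * (norm v)\<^sup>2) \<le> Re (i_ddbar (cutoff s) z v (\<i> *s v))"
          using K by (simp add: C_def field_simps)
        then show "Re (of_real C * i_ddbar (\<lambda>w. (norm w)\<^sup>2) z v (\<i> *s v)) \<le>
            Re (i_ddbar (cutoff s) z v (\<i> *s v))"
          by (simp add: levi_norm_square)
      qed
    next
      have "support_on \<Omega> (cutoff s) \<subseteq> cball 0 R"
        using cutoff_support[OF _ _ s] by (auto simp: support_on_def R_def K_def)
      then have "(top_of_set \<Omega>) closure_of (support_on \<Omega> (cutoff s)) \<subseteq> cball 0 R \<inter> \<Omega>"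
        by (auto simp: closure_of_subtopology dest!: closure_minimal[OF _ closed_cball, THEN subsetD, rotated])
      moreover have "cball 0 R \<subseteq> ball (std_basis first_index :: (complex, 'n) vec) (R + 2)"
      proof
        fix z :: "(complex, 'n) vec"
        assume "z \<in> cball 0 R"
        then show "z \<in> ball (std_basis first_index) (R + 2)"
          using norm_triangle_ineq4[of "std_basis first_index" z] by (simp add: dist_norm norm_std_basis)
      qed
      ultimately show "(top_of_set \<Omega>) closure_of (support_on \<Omega> (cutoff s)) \<subseteq> ball (std_basis first_index) (R + 2) \<inter> \<Omega>"
        by blast
    qed
  qed
  then show ?thesis using C R by (intro exI[of _ C] conjI exI[of _ "R + 2"] ballI) auto
qed

end
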